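(* The binary operation $\star$ on $\mathbf{L}$ is a $t_{lor}$-norm on $\mathbf{L}$. In particular, $\star$ is a $t_r$-norm on $\mathbf{L}$.
   Context: Let $I=[0,1]$ and let $\mathbf{M}$ be the set of all functions $I\to I$. Write $\wedge,\vee$ for minimum and maximum. A function $f\in\mathbf{M}$ is normal if $\sup_{x\in I} f(x)=1$, and convex if $f(y)\ge f(x)\wedge f(z)$ whenever $0\le x\le y\le z\le 1$. $\mathbf{L}$ is the set of all normal and convex functions in $\mathbf{M}$. For $B\subseteq I$, $\mathbf{1}_B$ is the characteristic function of $B$ on $I$. $\mathbf{J}=\{\mathbf{1}_{\{x\}}:x\in I\}$ and $\mathbf{K}=\{\mathbf{1}_{[a,b]}:0\le a\le b\le 1\}$. For $f,g\in\mathbf{M}$: $(f\sqcup g)(x)=\sup\{f(y)\wedge g(z): y\vee z=x\}$, $(f\sqcap g)(x)=\sup\{f(y)\wedge g(z): y\wedge z=x\}$, and $f\sqsubseteq g$ means $f\sqcap g=f$. Define $\barwedge$ on $\mathbf{M}$ by $(f\barwedge g)(x)=(f\sqcap g)(x)$ for $x\in[0,1)$ and $(f\barwedge g)(1)=0$. Define $\star:\mathbf{L}^2\to\mathbf{M}$ as follows: if $f=\mathbf{1}_{\{1\}}$, then $f\star g=g\star f=g$; if $g=\mathbf{1}_{\{1\}}$, then $f\star g=g\star f=f$; if $f\ne\mathbf{1}_{\{1\}}$ and $g\ne\mathbf{1}_{\{1\}}$, then $f\star g=f\sqcap g$ when $f(1)\wedge g(1)=1$, and $f\star g=f\barwedge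 g$ when $f(1)\wedge g(1)<1$. A binary operation $T:\mathbf{L}^2\to\mathbf{L}$ (so in particular taking values in $\mathbf{L}$) is a $t_r$-norm if: (O1) $T(f,g)=T(g,f)$ for all $f,g\in\mathbf{L}$; (O2) $T(T(f,g),h)=T(f,T(g,h))$ for all $f,g,h\in\mathbf{L}$; (O3) $T(f,\mathbf{1}_{\{1\}})=f$ for all $f\in\mathbf{L}$; (O4) for $f,g,h\in\mathbf{L}$ with $f\sqsubseteq g$, $T(f,h)\sqsubseteq T(g,h)$; (O5) $T(\mathbf{1}_{[0,1]},\mathbf{1}_{[a,b]})=\mathbf{1}_{[0,b]}$ for all $0\le a\le b\le 1$; (O6) $T$ is closed on $\mathbf{J}$ (i.e. $T(f,g)\in\mathbf{J}$ for $f,g\in\mathbf{J}$); (O7) $T$ is closed on $\mathbf{K}$. A binary operation $T:\mathbf{L}^2\to\mathbf{L}$ is a lattice-ordered $t_r$-norm ($t_{lor}$-norm) if it satisfies (O1), (O2), (O3), (O5), (O6), (O7) and, for all $f,g,h\in\mathbf{L}$, (O4$'$) $T(f,g\sqcup h)=T(f,g)\sqcup T(f,h)$ and (O4$''$) $T(f,g\sqcap h)=T(f,g)\sqcap T(f,h)$. *)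

theory Defs
  imports "HOL-Analysis.Analysis"
begin

abbreviation I :: "real set" where
  "I \<equiv> {0..1}"

text \<open>Functions on the unit interval are extensional (\<open>undefined\<close> outside \<open>I\<close>), so that
  HOL equality between members of \<open>M\<close> is pointwise equality on \<open>I\<close>.\<close>

definition M :: "(real \<Rightarrow> real) set" where
  "M = I \<rightarrow>\<^sub>E I"

definition normal_fun :: "(real \<Rightarrow> real) \<Rightarrow> bool" where
  "normal_fun f \<longleftrightarrow> (SUP x\<in>I. f x) = 1"

definition convex_fun :: "(real \<Rightarrow> real) \<Rightarrow> bool" where
  "convex_fun f \<longleftrightarrow> (\<forall>x y z. 0 \<le> x \<and> x \<le> y \<and> y \<le> z \<and> z \<le> 1 \<longrightarrow> min (f x) (f z) \<le> f y)"

definition L :: "(real \<Rightarrow> real) set" where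
  "L = {f \<in> M. normal_fun f \<and> convex_fun f}"

definition char_fun :: "real set \<Rightarrow> real \<Rightarrow> real" where
  "char_fun B = (\<lambda>x\<in>I. indicator B x)"

definition J :: "(real \<Rightarrow> real) set" where
  "J = {char_fun {x} | x. x \<in> I}"

definition K :: "(real \<Rightarrow> real) set" where
  "K = {char_fun {a..b} | a b. 0 \<le> a \<and> a \<le> b \<and> b \<le> 1}"

text \<open>For \<open>f, g \<in> M\<close> and \<open>x \<in> I\<close> the sets below are nonempty (take \<open>y = z = x\<close>) and contained
  in \<open>I\<close>, so the real-valued \<open>Sup\<close> is the genuine supremum.\<close>

definition join :: "(real \<Rightarrow> real) \<Rightarrow> (real \<Rightarrow> real) \<Rightarrow> real \<Rightarrow> real" where
  "join f g = (\<lambda>x\<in>I. Sup {min (f y) (g z) | y z. y \<in> I \<and> z \<in> I \<and> max y z = x})"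

definition meet :: "(real \<Rightarrow> real) \<Rightarrow> (real \<Rightarrow> real) \<Rightarrow> real \<Rightarrow> real" where
  "meet f g = (\<lambda>x\<in>I. Sup {min (f y) (g z) | y z. y \<in> I \<and> z \<in> I \<and> min y z = x})"

definition le_meet :: "(real \<Rightarrow> real) \<Rightarrow> (real \<Rightarrow> real) \<Rightarrow> bool" where
  "le_meet f g \<longleftrightarrow> meet f g = f"

definition barwedge :: "(real \<Rightarrow> real) \<Rightarrow> (real \<Rightarrow> real) \<Rightarrow> real \<Rightarrow> real" where
  "barwedge f g = (\<lambda>x\<in>I. if x = 1 then 0 else meet f g x)"

text \<open>On \<open>L\<close> values are at most \<open>1\<close>, so the final \<open>else\<close> is the case
  \<open>min (f 1) (g 1) < 1\<close>.\<close>

definition star :: "(real \<Rightarrow> real) \<Rightarrow> (real \<Rightarrow> real) \<Rightarrow> real \<Rightarrow> real" where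
  "star f g =
    (if f = char_fun {1} then g
     else if g = char_fun {1} then f
     else if min (f 1) (g 1) = 1 then meet f g
     else barwedge f g)"

definition closed_on ::
  "(real \<Rightarrow> real) set \<Rightarrow> ((real \<Rightarrow> real) \<Rightarrow> (real \<Rightarrow> real) \<Rightarrow> (real \<Rightarrow> real)) \<Rightarrow> bool" where
  "closed_on A T \<longleftrightarrow> (\<forall>f\<in>A. \<forall>g\<in>A. T f g \<in> A)"

definition tr_norm :: "((real \<Rightarrow> real) \<Rightarrow> (real \<Rightarrow> real) \<Rightarrow> (real \<Rightarrow> real)) \<Rightarrow> bool" where
  "tr_norm T \<longleftrightarrow>
    closed_on L T \<and>
    (\<forall>f\<in>L. \<forall>g\<in>L. T f g = T g f) \<and>
    (\<forall>f\<in>L. \<forall>g\<in>L. \<forall>h\<in>L. T (T f g) h = T f (T g h)) \<and>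
    (\<forall>f\<in>L. T f (char_fun {1}) = f) \<and>
    (\<forall>f\<in>L. \<forall>g\<in>L. \<forall>h\<in>L. le_meet f g \<longrightarrow> le_meet (T f h) (T g h)) \<and>
    (\<forall>a b. 0 \<le> a \<and> a \<le> b \<and> b \<le> 1 \<longrightarrow>
      T (char_fun {0..1}) (char_fun {a..b}) = char_fun {0..b}) \<and>
    closed_on J T \<and>
    closed_on K T"

definition tlor_norm :: "((real \<Rightarrow> real) \<Rightarrow> (real \<Rightarrow> real) \<Rightarrow> (real \<Rightarrow> real)) \<Rightarrow> bool" where
  "tlor_norm T \<longleftrightarrow>
    closed_on L T \<and>
    (\<forall>f\<in>L. \<forall>g\<in>L. T f g = T g f) \<and>
    (\<forall>f\<in>L. \<forall>g\<in>L. \<forall>h\<in>L. T (T f g) h = T f (T g h)) \<and>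
    (\<forall>f\<in>L. T f (char_fun {1}) = f) \<and>
    (\<forall>f\<in>L. \<forall>g\<in>L. \<forall>h\<in>L. T f (join g h) = join (T f g) (T f h)) \<and>
    (\<forall>f\<in>L. \<forall>g\<in>L. \<forall>h\<in>L. T f (meet g h) = meet (T f g) (T f h)) \<and>
    (\<forall>a b. 0 \<le> a \<and> a \<le> b \<and> b \<le> 1 \<longrightarrow>
      T (char_fun {0..1}) (char_fun {a..b}) = char_fun {0..b}) \<and>
    closed_on J T \<and>
    closed_on K T"

end

theory Submission
  imports Defs
begin

text \<open>
  A member of \<open>L\<close> is determined by its strict level sets \<open>{x \<in> I. t < f x}\<close>, \<open>0 \<le> t < 1\<close>, and
  membership in \<open>L\<close> means precisely that these are nonempty intervals. Since a supremum exceeds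
  \<open>t\<close> iff some member does, the level sets of \<open>meet f g\<close> and \<open>join f g\<close> are the elementwise minima
  and maxima of those of \<open>f\<close> and \<open>g\<close>. So every lattice law in \<open>L\<close> reduces to one about intervals
  (\<open>smax_smin_absorb\<close>, \<open>smin_smax_distrib\<close>), and \<open>L\<close> is a distributive lattice with top
  \<open>char_fun {1}\<close>.

  Let \<open>trim k\<close> be \<open>k\<close> if \<open>k 1 = 1\<close>, and \<open>k\<close> with its value at \<open>1\<close> lowered to \<open>0\<close> otherwise. Because
  \<open>meet f g 1 = min (f 1) (g 1)\<close>, the operation in question is \<open>trim (meet f g)\<close> as long as neither
  argument is the top, and the top is its unit. The crucial fact is that \<open>trim\<close> is an idempotent,
  deflationary lattice endomorphism of \<open>L\<close> (\<open>trim_meet\<close>, \<open>trim_join\<close>, \<open>trim_idem\<close>, \<open>meet_trim\<close>). What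
  makes it compatible with \<open>meet\<close> is that if \<open>k 1 < 1\<close> then every level set of \<open>k\<close> reaches below
  \<open>1\<close>; being an interval, it then loses nothing but the point \<open>1\<close> itself when \<open>1\<close> is removed, and
  minima below \<open>1\<close> can be formed as before.

  The top is neither a meet nor a join of two smaller elements and is the only element sent to the
  top by \<open>trim\<close>, so the exceptional clauses never interfere. Associativity is then
  \<open>trim (meet (trim k) h) = trim (meet k h)\<close>; the two distributive laws are those of \<open>L\<close> pushed
  through \<open>trim\<close>, except when one of the arguments is the top, where they become absorption.
  Monotonicity is a consequence of distributivity over \<open>meet\<close>. On characteristic functions of
  intervals \<open>trim\<close> does nothing, so there the operation is simply the minimum of intervals.
\<close>

section \<open>Elementwise minima and maxima of sets of reals\<close>

definition smin :: "real set \<Rightarrow> real set \<Rightarrow> real set" where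
  "smin A B = {min a b | a b. a \<in> A \<and> b \<in> B}"

definition smax :: "real set \<Rightarrow> real set \<Rightarrow> real set" where
  "smax A B = {max a b | a b. a \<in> A \<and> b \<in> B}"

lemma sminI: "a \<in> A \<Longrightarrow> b \<in> B \<Longrightarrow> x = min a b \<Longrightarrow> x \<in> smin A B"
  unfolding smin_def by blast

lemma smaxI: "a \<in> A \<Longrightarrow> b \<in> B \<Longrightarrow> x = max a b \<Longrightarrow> x \<in> smax A B"
  unfolding smax_def by blast

lemma sminE: "x \<in> smin A B \<Longrightarrow> (\<And>a b. a \<in> A \<Longrightarrow> b \<in> B \<Longrightarrow> x = min a b \<Longrightarrow> P) \<Longrightarrow> P"
  unfolding smin_def by blast

lemma smaxE: "x \<in> smax A B \<Longrightarrow> (\<And>a b. a \<in> A \<Longrightarrow> b \<in> B \<Longrightarrow> x = max a b \<Longrightarrow> P) \<Longrightarrow> P"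
  unfolding smax_def by blast

lemma smin_commute: "smin A B = smin B A"
  unfolding smin_def by (metis min.commute)

lemma smax_commute: "smax A B = smax B A"
  unfolding smax_def by (metis max.commute)

lemma smin_assoc: "smin (smin A B) C = smin A (smin B C)"
proof
  show "smin (smin A B) C \<subseteq> smin A (smin B C)"
  proof
    fix x assume "x \<in> smin (smin A B) C"
    then obtain a b c where *: "a \<in> A" "b \<in> B" "c \<in> C" and "x = min (min a b) c"
      by (blast elim: sminE)
    then have "x = min a (min b c)" by (simp add: min.assoc)
    then show "x \<in> smin A (smin B C)" using * by (blast intro: sminI)
  qed
  show "smin A (smin B C) \<subseteq> smin (smin A B) C"
  proof
    fix x assume "x \<in> smin A (smin B C)"
    then obtain a b c where *: "a \<in> A" "b \<in> B" "c \<in> C" and "x = min a (min b c)"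
      by (blast elim: sminE)
    then have "x = min (min a b) c" by (simp add: min.assoc)
    then show "x \<in> smin (smin A B) C" using * by (blast intro: sminI)
  qed
qed

lemma smin_idem: "smin A A = A"
proof
  show "smin A A \<subseteq> A" by (auto simp: smin_def min_def)
  show "A \<subseteq> smin A A" by (auto intro: sminI[of x _ x for x])
qed

lemma smin_nonempty: "A \<noteq> {} \<Longrightarrow> B \<noteq> {} \<Longrightarrow> smin A B \<noteq> {}"
  unfolding smin_def by blast

lemma smax_nonempty: "A \<noteq> {} \<Longrightarrow> B \<noteq> {} \<Longrightarrow> smax A B \<noteq> {}"
  unfolding smax_def by blast

lemma is_interval_between:
  fixes A :: "real set"
  assumes "is_interval A" "a \<in> A" "b \<in> A" "a \<le> x" "x \<le> b"
  shows "x \<in> A"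
  using assms unfolding is_interval_1 by blast

lemma is_interval_smin:
  assumes A: "is_interval A" and B: "is_interval B"
  shows "is_interval (smin A B)"
  unfolding is_interval_1
proof (intro ballI allI impI)
  fix u v x assume u: "u \<in> smin A B" and v: "v \<in> smin A B" and x: "u \<le> x \<and> x \<le> v"
  obtain a b where ab: "a \<in> A" "b \<in> B" "u = min a b" using u by (rule sminE)
  obtain a' b' where ab': "a' \<in> A" "b' \<in> B" "v = min a' b'" using v by (rule sminE)
  have le: "x \<le> a'" "x \<le> b'" using x ab' by auto
  consider "a \<le> x" | "b \<le> x" using x ab by linarith
  then show "x \<in> smin A B"
  proof cases
    case 1
    then have "x \<in> A" using is_interval_between[OF A ab(1) ab'(1)] le by blast
    then show ?thesis using ab' le by (auto intro: sminI[of x A b' B])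
  next
    case 2
    then have "x \<in> B" using is_interval_between[OF B ab(2) ab'(2)] le by blast
    then show ?thesis using ab' le by (auto intro: sminI[of a' A x B])
  qed
qed

lemma is_interval_smax:
  assumes A: "is_interval A" and B: "is_interval B"
  shows "is_interval (smax A B)"
  unfolding is_interval_1
proof (intro ballI allI impI)
  fix u v x assume u: "u \<in> smax A B" and v: "v \<in> smax A B" and x: "u \<le> x \<and> x \<le> v"
  obtain a b where ab: "a \<in> A" "b \<in> B" "u = max a b" using u by (rule smaxE)
  obtain a' b' where ab': "a' \<in> A" "b' \<in> B" "v = max a' b'" using v by (rule smaxE)
  have le: "a \<le> x" "b \<le> x" using x ab by auto
  consider "x \<le> a'" | "x \<le> b'" using x ab' by linarith
  then show "x \<in> smax A B"
  proof cases
    case 1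
    then have "x \<in> A" using is_interval_between[OF A ab(1) ab'(1)] le by blast
    then show ?thesis using ab le by (auto intro: smaxI[of x A b B])
  next
    case 2
    then have "x \<in> B" using is_interval_between[OF B ab(2) ab'(2)] le by blast
    then show ?thesis using ab le by (auto intro: smaxI[of a A x B])
  qed
qed

text \<open>The value \<open>max a (min a' b)\<close>, formed with possibly different elements of \<open>A\<close>, lies between
  \<open>a\<close> and \<open>max a a'\<close>; this is where convexity of \<open>A\<close> enters.\<close>

lemma smax_smin_absorb:
  assumes A: "is_interval A" and B: "B \<noteq> {}"
  shows "smax A (smin A B) = A"
proof
  show "smax A (smin A B) \<subseteq> A"
  proof
    fix x assume "x \<in> smax A (smin A B)"
    then obtain a a' b where *: "a \<in> A" "a' \<in> A" "x = max a (min a' b)"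
      by (auto elim!: smaxE sminE)
    have "max a a' \<in> A" using * by (simp add: max_def)
    then show "x \<in> A" using is_interval_between[OF A *(1)] * by auto
  qed
  obtain b where "b \<in> B" using B by blast
  then show "A \<subseteq> smax A (smin A B)"
    by (auto intro!: smaxI[where b = "min _ b"] sminI)
qed

text \<open>Distributivity of \<open>min\<close> over \<open>max\<close> gives one inclusion. In the other one, two different
  elements \<open>a\<close>, \<open>a'\<close> of \<open>A\<close> are used; when neither serves for both minima, the resulting value lies
  between them and itself belongs to \<open>A\<close>.\<close>

lemma smin_smax_distrib:
  assumes A: "is_interval A"
  shows "smin A (smax B C) = smax (smin A B) (smin A C)"
proof
  show "smin A (smax B C) \<subseteq> smax (smin A B) (smin A C)"
    by (auto elim!: smaxE sminE simp: min_max_distrib2 intro!: smaxI sminI)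
  show "smax (smin A B) (smin A C) \<subseteq> smin A (smax B C)"
  proof
    fix x assume "x \<in> smax (smin A B) (smin A C)"
    then obtain a b a' c where *: "a \<in> A" "b \<in> B" "a' \<in> A" "c \<in> C"
      and x: "x = max (min a b) (min a' c)"
      by (auto elim!: smaxE sminE)
    have s: "max b c \<in> smax B C" using * by (auto intro: smaxI)
    have "x = min a (max b c) \<or> x = min a' (max b c) \<or>
        x \<le> max b c \<and> (a \<le> x \<and> x \<le> a' \<or> a' \<le> x \<and> x \<le> a)"
      unfolding x by (auto simp: min_def max_def)
    then show "x \<in> smin A (smax B C)"
    proof (elim disjE)
      assume "x = min a (max b c)"
      then show ?thesis using * s by (auto intro: sminI)
    next
      assume "x = min a' (max b c)"
      then show ?thesis using * s by (auto intro: sminI)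
    next
      assume h: "x \<le> max b c \<and> (a \<le> x \<and> x \<le> a' \<or> a' \<le> x \<and> x \<le> a)"
      then have "x \<in> A" using is_interval_between[OF A] * by blast
      then show ?thesis using s h by (intro sminI[of x A "max b c"]) auto
    qed
  qed
qed

lemma smin_greatest: "A \<subseteq> {..m} \<Longrightarrow> smin {m} A = A"
  by (fastforce elim!: sminE intro: sminI[of m])

lemma smax_greatest: "A \<subseteq> {..m} \<Longrightarrow> A \<noteq> {} \<Longrightarrow> smax {m} A = {m}"
  by (fastforce elim!: smaxE intro: smaxI[of m])

lemma smin_atLeastAtMost:
  assumes "a \<le> b" "c \<le> d"
  shows "smin {a..b} {c..d} = {min a c..min b d}"
proof
  show "smin {a..b} {c..d} \<subseteq> {min a c..min b d}"
    by (auto elim!: sminE)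
  show "{min a c..min b d} \<subseteq> smin {a..b} {c..d}"
  proof
    fix x assume x: "x \<in> {min a c..min b d}"
    then have "x = min (max a x) (max c x)" by (auto simp: min_def max_def split: if_splits)
    then show "x \<in> smin {a..b} {c..d}"
      using x assms by (intro sminI[of "max a x" _ "max c x"]) auto
  qed
qed

text \<open>Only the pairs \<open>(a, m)\<close> with \<open>a < m\<close> need attention: \<open>m\<close> can be replaced by an element of
  \<open>B\<close> that lies strictly below \<open>m\<close> but not below \<open>a\<close>.\<close>

lemma smin_remove_greatest:
  assumes B: "is_interval B" "B \<subseteq> {..m}" "B - {m} \<noteq> {}"
  shows "smin A (B - {m}) = smin A B - {m}"
proof
  show "smin A (B - {m}) \<subseteq> smin A B - {m}"
  proof
    fix x assume "x \<in> smin A (B - {m})"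
    then obtain a b where *: "a \<in> A" "b \<in> B" "b \<noteq> m" "x = min a b" by (blast elim: sminE)
    then have "b < m" using B(2) by force
    then show "x \<in> smin A B - {m}" using * by (auto intro: sminI)
  qed
  show "smin A B - {m} \<subseteq> smin A (B - {m})"
  proof
    fix x assume "x \<in> smin A B - {m}"
    then obtain a b where *: "a \<in> A" "b \<in> B" "x = min a b" "x \<noteq> m" by (auto elim!: sminE)
    show "x \<in> smin A (B - {m})"
    proof (cases "b = m")
      case False
      then show ?thesis using * by (auto intro: sminI)
    next
      case True
      then have "a < m" using * by (auto simp: min_def split: if_splits)
      obtain b' where b': "b' \<in> B" "b' < m" using B(2,3) by force
      have "max a b' \<in> B"
        using is_interval_between[OF B(1) b'(1) *(2)] True \<open>a < m\<close> b' by auto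
      then have "max a b' \<in> B - {m}" using \<open>a < m\<close> b' by auto
      moreover have "x = min a (max a b')" using * True \<open>a < m\<close> by auto
      ultimately show ?thesis using * by (blast intro: sminI)
    qed
  qed
qed

lemma smax_remove_greatest:
  assumes "A \<subseteq> {..m}" "B \<subseteq> {..m}"
  shows "smax (A - {m}) (B - {m}) = smax A B - {m}"
proof
  show "smax (A - {m}) (B - {m}) \<subseteq> smax A B - {m}"
    unfolding smax_def by (auto simp: max_def split: if_splits)
  show "smax A B - {m} \<subseteq> smax (A - {m}) (B - {m})"
  proof
    fix x assume "x \<in> smax A B - {m}"
    then obtain a b where *: "a \<in> A" "b \<in> B" "x = max a b" "x \<noteq> m" by (blast elim: smaxE)
    then have "a \<le> m" "b \<le> m" using assms by auto
    then have "a \<noteq> m" "b \<noteq> m" using * by auto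
    then show "x \<in> smax (A - {m}) (B - {m})" using * by (blast intro: smaxI)
  qed
qed

text \<open>A maximum involving \<open>m \<in> B\<close> equals \<open>m\<close>, and since \<open>m \<in> A\<close> it is also attained with any other
  element of \<open>B\<close>.\<close>

lemma smax_remove_greatest_right:
  assumes m: "m \<in> A" and A: "A \<subseteq> {..m}" and B: "B \<subseteq> {..m}" "B - {m} \<noteq> {}"
  shows "smax A (B - {m}) = smax A B"
proof
  show "smax A (B - {m}) \<subseteq> smax A B"
    by (auto elim!: smaxE intro: smaxI)
  show "smax A B \<subseteq> smax A (B - {m})"
  proof
    fix x assume "x \<in> smax A B"
    then obtain a b where *: "a \<in> A" "b \<in> B" "x = max a b" by (auto elim!: smaxE)
    obtain b' where b': "b' \<in> B - {m}" using B by blast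
    show "x \<in> smax A (B - {m})"
    proof (cases "b = m")
      case False
      then show ?thesis using * by (auto intro: smaxI)
    next
      case True
      have "a \<le> m" "b' \<le> m" using * A B b' by auto
      then have "x = max m b'" using * True by simp
      then show ?thesis using m b' by (auto intro: smaxI)
    qed
  qed
qed

section \<open>Level sets\<close>

definition level :: "(real \<Rightarrow> real) \<Rightarrow> real \<Rightarrow> real set" where
  "level f t = {x \<in> I. t < f x}"

lemma level_le_1: "level f t \<subseteq> {..1}"
  by (auto simp: level_def)

lemma one_in_level: "1 \<in> level f t \<longleftrightarrow> t < f 1"
  by (simp add: level_def)

lemma M_value: "f \<in> M \<Longrightarrow> x \<in> I \<Longrightarrow> 0 \<le> f x \<and> f x \<le> 1"
  unfolding M_def by (metis PiE_mem atLeastAtMost_iff)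

lemma M_bdd_above:
  assumes "f \<in> M"
  shows "bdd_above (f ` I)"
proof (rule bdd_aboveI2)
  show "f x \<le> 1" if "x \<in> I" for x using M_value[OF assms that] by simp
qed

lemma M_I: "(\<And>x. x \<in> I \<Longrightarrow> 0 \<le> f x \<and> f x \<le> 1) \<Longrightarrow> (\<lambda>x\<in>I. f x) \<in> M"
  unfolding M_def by auto

lemma L_subset_M: "f \<in> L \<Longrightarrow> f \<in> M"
  by (simp add: L_def)

text \<open>A pointwise difference is detected at the smaller of the two values, which lies in
  \<open>[0, 1)\<close>.\<close>

lemma M_eqI_level:
  assumes f: "f \<in> M" and g: "g \<in> M"
    and eq: "\<And>t. 0 \<le> t \<Longrightarrow> t < 1 \<Longrightarrow> level f t = level g t"
  shows "f = g"
proof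
  fix x
  show "f x = g x"
  proof (cases "x \<in> I")
    case False
    then show ?thesis using f g unfolding M_def by (metis PiE_arb)
  next
    case True
    have lt: False if "p \<in> M" "q \<in> M" "p x < q x" "level p (p x) = level q (p x)" for p q
      using that True by (auto simp: level_def)
    have bd: "0 \<le> f x" "f x \<le> 1" "0 \<le> g x" "g x \<le> 1"
      using M_value[OF f True] M_value[OF g True] by auto
    show ?thesis
    proof (rule ccontr)
      assume "f x \<noteq> g x"
      then consider "f x < g x" | "g x < f x" by linarith
      then show False
        by cases (use lt[OF f g] lt[OF g f] eq[of "f x"] eq[of "g x"] bd in auto)
    qed
  qed
qed

lemma L_iff_level:
  "f \<in> L \<longleftrightarrow> f \<in> M \<and> (\<forall>t. 0 \<le> t \<and> t < 1 \<longrightarrow> level f t \<noteq> {} \<and> is_interval (level f t))"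
proof (intro iffI conjI allI impI)
  assume f: "f \<in> L"
  then have M: "f \<in> M" by (rule L_subset_M)
  then show "f \<in> M" .
  fix t :: real assume t: "0 \<le> t \<and> t < 1"
  have "bdd_above (f ` I)" by (rule M_bdd_above[OF M])
  moreover have "t < (SUP x\<in>I. f x)" using f t by (simp add: L_def normal_fun_def)
  ultimately have "\<exists>x\<in>I. t < f x" using less_cSUP_iff[of I f t] by simp
  then show "level f t \<noteq> {}" unfolding level_def by blast
  show "is_interval (level f t)"
    unfolding is_interval_1
  proof (intro ballI allI impI)
    fix a b x assume ab: "a \<in> level f t" "b \<in> level f t" and x: "a \<le> x \<and> x \<le> b"
    have "min (f a) (f b) \<le> f x"
    proof -
      have "convex_fun f" "0 \<le> a" "b \<le> 1" using f ab by (auto simp: L_def level_def)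
      then show ?thesis using x unfolding convex_fun_def by blast
    qed
    then show "x \<in> level f t" using ab x by (auto simp: level_def)
  qed
next
  assume *: "f \<in> M \<and> (\<forall>t. 0 \<le> t \<and> t < 1 \<longrightarrow> level f t \<noteq> {} \<and> is_interval (level f t))"
  then have M: "f \<in> M" by blast
  have bd: "bdd_above (f ` I)" by (rule M_bdd_above[OF M])
  have "(SUP x\<in>I. f x) \<le> 1" using M_value[OF M] by (intro cSUP_least) auto
  moreover have "\<not> (SUP x\<in>I. f x) < 1"
  proof
    assume lt: "(SUP x\<in>I. f x) < 1"
    have "0 \<le> f 0" using M_value[OF M] by simp
    also have "f 0 \<le> (SUP x\<in>I. f x)" using bd by (intro cSUP_upper) auto
    finally have "level f (SUP x\<in>I. f x) \<noteq> {}" using * lt by simp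
    then obtain x where "x \<in> level f (SUP x\<in>I. f x)" by (meson ex_in_conv)
    then have "x \<in> I" "(SUP x\<in>I. f x) < f x" by (auto simp: level_def)
    then show False using cSUP_upper[OF _ bd, of x] by simp
  qed
  ultimately have "normal_fun f" by (simp add: normal_fun_def)
  moreover have "convex_fun f"
    unfolding convex_fun_def
  proof (intro allI impI, rule ccontr)
    fix x y z :: real
    assume o: "0 \<le> x \<and> x \<le> y \<and> y \<le> z \<and> z \<le> 1" and "\<not> min (f x) (f z) \<le> f y"
    then have lt: "f y < f x" "f y < f z" by auto
    have "0 \<le> f y" "f y < 1" using M_value[OF M, of y] M_value[OF M, of x] o lt by auto
    then have "is_interval (level f (f y))" using * by simp
    moreover have "x \<in> level f (f y)" "z \<in> level f (f y)" using o lt by (auto simp: level_def)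
    ultimately have "y \<in> level f (f y)" using o is_interval_between by blast
    then show False by (simp add: level_def)
  qed
  ultimately show "f \<in> L" using M by (simp add: L_def)
qed

lemma L_level:
  assumes "f \<in> L" "0 \<le> t" "t < 1"
  shows "level f t \<noteq> {}" "is_interval (level f t)"
  using assms(2,3) assms(1)[unfolded L_iff_level] by simp_all

lemmas L_eqI_level = M_eqI_level[OF L_subset_M L_subset_M]

lemma level_char_fun: "0 \<le> t \<Longrightarrow> t < 1 \<Longrightarrow> level (char_fun B) t = B \<inter> I"
  by (auto simp: level_def char_fun_def indicator_def)

lemma char_fun_in_L:
  assumes "0 \<le> a" "a \<le> b" "b \<le> 1"
  shows "char_fun {a..b} \<in> L"
proof -
  have "char_fun {a..b} \<in> M"
    unfolding char_fun_def by (rule M_I) (simp add: indicator_def)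
  moreover have "level (char_fun {a..b}) t \<noteq> {} \<and> is_interval (level (char_fun {a..b}) t)"
    if "0 \<le> t \<and> t < 1" for t
  proof -
    have "{a..b} \<inter> I = {a..b}" using assms by auto
    then have "level (char_fun {a..b}) t = {a..b}" using that by (simp add: level_char_fun)
    then show ?thesis using assms by simp
  qed
  ultimately show ?thesis unfolding L_iff_level by blast
qed

lemma top_in_L: "char_fun {1} \<in> L"
  using char_fun_in_L[of 1 1] by simp

lemma level_top: "0 \<le> t \<Longrightarrow> t < 1 \<Longrightarrow> level (char_fun {1}) t = {1}"
  by (simp add: level_char_fun)

section \<open>The distributive lattice \<open>L\<close>\<close>

text \<open>Both operations are suprema over the fibres of a binary operation on \<open>I\<close>, and can be studied
  together in this form.\<close>

lemma fibre_Sup: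
  fixes op :: "real \<Rightarrow> real \<Rightarrow> real"
  assumes f: "f \<in> M" and g: "g \<in> M" and x: "x \<in> I" and idem: "op x x = x"
  defines "S \<equiv> {min (f y) (g z) | y z. y \<in> I \<and> z \<in> I \<and> op y z = x}"
  shows "0 \<le> Sup S \<and> Sup S \<le> 1"
    and "t < Sup S \<longleftrightarrow> (\<exists>y\<in>level f t. \<exists>z\<in>level g t. op y z = x)"
proof -
  have S01: "0 \<le> s \<and> s \<le> 1" if "s \<in> S" for s
  proof -
    obtain y z where yz: "y \<in> I" "z \<in> I" "s = min (f y) (g z)"
      using \<open>s \<in> S\<close> unfolding S_def by blast
    show ?thesis using M_value[OF f yz(1)] M_value[OF g yz(2)] unfolding yz(3)
      by (simp add: min_le_iff_disj)
  qed
  then have bdd: "bdd_above S" by (intro bdd_aboveI[of _ 1]) simp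
  have mem: "min (f x) (g x) \<in> S"
    unfolding S_def mem_Collect_eq by (intro exI[of _ x] conjI x idem refl)
  then have ne: "S \<noteq> {}" by blast
  have "0 \<le> min (f x) (g x)" using S01[OF mem] by blast
  also have "\<dots> \<le> Sup S" using mem bdd by (rule cSup_upper)
  finally show "0 \<le> Sup S \<and> Sup S \<le> 1"
    using cSup_least[OF ne, of 1] S01 by simp
  show "t < Sup S \<longleftrightarrow> (\<exists>y\<in>level f t. \<exists>z\<in>level g t. op y z = x)"
  proof
    assume "t < Sup S"
    then obtain s where "s \<in> S" "t < s" unfolding less_cSup_iff[OF ne bdd] by blast
    then obtain y z where "y \<in> I" "z \<in> I" "op y z = x" "t < f y" "t < g z"
      unfolding S_def by auto
    then show "\<exists>y\<in>level f t. \<exists>z\<in>level g t. op y z = x" unfolding level_def by blast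
  next
    assume "\<exists>y\<in>level f t. \<exists>z\<in>level g t. op y z = x"
    then obtain y z where yz: "y \<in> I" "z \<in> I" "op y z = x" "t < f y" "t < g z"
      unfolding level_def by blast
    then have "min (f y) (g z) \<in> S" unfolding S_def by blast
    moreover have "t < min (f y) (g z)" using yz by simp
    ultimately show "t < Sup S" using less_cSup_iff[OF ne bdd] by blast
  qed
qed

lemma meet_in_M:
  assumes "f \<in> M" "g \<in> M"
  shows "meet f g \<in> M"
  unfolding meet_def by (rule M_I) (rule fibre_Sup(1)[OF assms], auto)

lemma join_in_M:
  assumes "f \<in> M" "g \<in> M"
  shows "join f g \<in> M"
  unfolding join_def by (rule M_I) (rule fibre_Sup(1)[OF assms], auto)

lemma level_meet:
  assumes f: "f \<in> M" and g: "g \<in> M"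
  shows "level (meet f g) t = smin (level f t) (level g t)"
proof -
  have "x \<in> level (meet f g) t \<longleftrightarrow> x \<in> smin (level f t) (level g t)" if "x \<in> I" for x
  proof -
    have "x \<in> level (meet f g) t \<longleftrightarrow>
        t < Sup {min (f y) (g z) | y z. y \<in> I \<and> z \<in> I \<and> min y z = x}"
      using that by (simp add: level_def meet_def)
    also have "\<dots> \<longleftrightarrow> (\<exists>y\<in>level f t. \<exists>z\<in>level g t. min y z = x)"
      by (rule fibre_Sup(2)[OF f g that]) simp
    also have "\<dots> \<longleftrightarrow> x \<in> smin (level f t) (level g t)"
      unfolding smin_def by blast
    finally show ?thesis .
  qed
  moreover have "smin (level f t) (level g t) \<subseteq> I"
    by (auto elim!: sminE simp: level_def min_def)
  moreover have "level (meet f g) t \<subseteq> I" by (auto simp: level_def)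
  ultimately show ?thesis by blast
qed

lemma level_join:
  assumes f: "f \<in> M" and g: "g \<in> M"
  shows "level (join f g) t = smax (level f t) (level g t)"
proof -
  have "x \<in> level (join f g) t \<longleftrightarrow> x \<in> smax (level f t) (level g t)" if "x \<in> I" for x
  proof -
    have "x \<in> level (join f g) t \<longleftrightarrow>
        t < Sup {min (f y) (g z) | y z. y \<in> I \<and> z \<in> I \<and> max y z = x}"
      using that by (simp add: level_def join_def)
    also have "\<dots> \<longleftrightarrow> (\<exists>y\<in>level f t. \<exists>z\<in>level g t. max y z = x)"
      by (rule fibre_Sup(2)[OF f g that]) simp
    also have "\<dots> \<longleftrightarrow> x \<in> smax (level f t) (level g t)"
      unfolding smax_def by blast
    finally show ?thesis .
  qed
  moreover have "smax (level f t) (level g t) \<subseteq> I"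
    by (auto elim!: smaxE simp: level_def max_def)
  moreover have "level (join f g) t \<subseteq> I" by (auto simp: level_def)
  ultimately show ?thesis by blast
qed

lemma level_meet_L: "f \<in> L \<Longrightarrow> g \<in> L \<Longrightarrow> level (meet f g) t = smin (level f t) (level g t)"
  by (simp add: level_meet L_subset_M)

lemma level_join_L: "f \<in> L \<Longrightarrow> g \<in> L \<Longrightarrow> level (join f g) t = smax (level f t) (level g t)"
  by (simp add: level_join L_subset_M)

lemma meet_in_L:
  assumes "f \<in> L" "g \<in> L"
  shows "meet f g \<in> L"
  using assms unfolding L_iff_level
  by (simp add: meet_in_M level_meet smin_nonempty is_interval_smin)

lemma join_in_L:
  assumes "f \<in> L" "g \<in> L"
  shows "join f g \<in> L"
  using assms unfolding L_iff_level
  by (simp add: join_in_M level_join smax_nonempty is_interval_smax)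

lemma meet_commute: "f \<in> L \<Longrightarrow> g \<in> L \<Longrightarrow> meet f g = meet g f"
  by (rule L_eqI_level) (simp_all add: meet_in_L level_meet_L smin_commute)

lemma join_commute: "f \<in> L \<Longrightarrow> g \<in> L \<Longrightarrow> join f g = join g f"
  by (rule L_eqI_level) (simp_all add: join_in_L level_join_L smax_commute)

lemma meet_assoc: "f \<in> L \<Longrightarrow> g \<in> L \<Longrightarrow> h \<in> L \<Longrightarrow> meet (meet f g) h = meet f (meet g h)"
  by (rule L_eqI_level) (simp_all add: meet_in_L level_meet_L smin_assoc)

lemma meet_idem: "f \<in> L \<Longrightarrow> meet f f = f"
  by (rule L_eqI_level) (simp_all add: meet_in_L level_meet_L smin_idem)

lemma join_meet_absorb: "f \<in> L \<Longrightarrow> g \<in> L \<Longrightarrow> join f (meet f g) = f"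
  by (rule L_eqI_level)
    (simp_all add: join_in_L meet_in_L level_meet_L level_join_L smax_smin_absorb L_level)

lemma meet_join_distrib:
  "f \<in> L \<Longrightarrow> g \<in> L \<Longrightarrow> h \<in> L \<Longrightarrow> meet f (join g h) = join (meet f g) (meet f h)"
  by (rule L_eqI_level)
    (simp_all add: join_in_L meet_in_L level_meet_L level_join_L smin_smax_distrib L_level)

lemma meet_distrib_meet:
  assumes "f \<in> L" "g \<in> L" "h \<in> L"
  shows "meet f (meet g h) = meet (meet f g) (meet f h)"
proof -
  have "meet (meet f g) (meet f h) = meet (meet g f) (meet f h)"
    using assms by (simp add: meet_commute[of f g])
  also have "\<dots> = meet g (meet (meet f f) h)"
    using assms by (simp add: meet_assoc meet_in_L del: meet_idem)
  also have "\<dots> = meet (meet g f) h" using assms by (simp add: meet_idem meet_assoc)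
  also have "\<dots> = meet f (meet g h)"
    using assms by (simp add: meet_commute[of g f] meet_assoc)
  finally show ?thesis by simp
qed

lemma meet_top: "f \<in> L \<Longrightarrow> meet (char_fun {1}) f = f"
  by (rule L_eqI_level)
    (simp_all add: meet_in_L top_in_L level_meet_L level_top smin_greatest level_le_1)

lemma join_top: "f \<in> L \<Longrightarrow> join (char_fun {1}) f = char_fun {1}"
  by (rule L_eqI_level)
    (simp_all add: join_in_L top_in_L level_join_L level_top smax_greatest level_le_1 L_level)

lemma meet_char_fun:
  assumes "0 \<le> a" "a \<le> b" "b \<le> 1" "0 \<le> c" "c \<le> d" "d \<le> 1"
  shows "meet (char_fun {a..b}) (char_fun {c..d}) = char_fun {min a c..min b d}"
proof (rule L_eqI_level)
  show "meet (char_fun {a..b}) (char_fun {c..d}) \<in> L"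
    using assms by (simp add: meet_in_L char_fun_in_L)
  show "char_fun {min a c..min b d} \<in> L"
    using assms by (intro char_fun_in_L) auto
  have in_I: "{a..b} \<inter> I = {a..b}" "{c..d} \<inter> I = {c..d}"
    "{min a c..min b d} \<inter> I = {min a c..min b d}"
    using assms by auto
  show "level (meet (char_fun {a..b}) (char_fun {c..d})) t = level (char_fun {min a c..min b d}) t"
    if "0 \<le> t" "t < 1" for t
    using that assms
    by (simp only: level_meet_L char_fun_in_L level_char_fun in_I smin_atLeastAtMost)
qed

text \<open>A level set of height above both \<open>t\<close> and \<open>k 1\<close> does not contain \<open>1\<close>, but is nonempty because
  \<open>k\<close> is normal.\<close>

lemma level_reaches_below_one:
  assumes k: "k \<in> L" "k 1 \<noteq> 1" and t: "0 \<le> t" "t < 1"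
  shows "level k t - {1} \<noteq> {}"
proof -
  have "k 1 < 1" using M_value[OF L_subset_M[OF k(1)], of 1] k(2) by simp
  then obtain x where x: "x \<in> level k (max t (k 1))"
    using L_level(1)[OF k(1), of "max t (k 1)"] t by (auto simp: le_max_iff_disj)
  then have "x \<noteq> 1" by (auto simp: one_in_level)
  then show ?thesis using x by (auto simp: level_def)
qed

lemma non_top_reaches_below_one:
  assumes k: "k \<in> L" "k \<noteq> char_fun {1}"
  obtains x where "x \<in> level k 0" "x < 1"
proof -
  have "\<not> level k 0 \<subseteq> {1}"
  proof
    assume "level k 0 \<subseteq> {1}"
    have "level k t = level (char_fun {1}) t" if "0 \<le> t" "t < 1" for t
    proof -
      have "level k t \<subseteq> level k 0" using that by (auto simp: level_def)
      then have "level k t = {1}"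
        using \<open>level k 0 \<subseteq> {1}\<close> L_level(1)[OF k(1) that] by blast
      then show ?thesis using that by (simp add: level_top)
    qed
    then show False using L_eqI_level[OF k(1) top_in_L] k(2) by blast
  qed
  then obtain x where "x \<in> level k 0" "x \<noteq> 1" by blast
  moreover then have "x < 1" by (auto simp: level_def)
  ultimately show thesis using that by blast
qed

lemma meet_eq_top_iff:
  assumes "f \<in> L" "g \<in> L"
  shows "meet f g = char_fun {1} \<longleftrightarrow> f = char_fun {1} \<and> g = char_fun {1}"
proof
  assume top: "meet f g = char_fun {1}"
  have "join f (char_fun {1}) = f" "join g (char_fun {1}) = g"
    using join_meet_absorb[of f g] join_meet_absorb[of g f] meet_commute[of f g] assms top by auto
  then show "f = char_fun {1} \<and> g = char_fun {1}"
    using assms join_top join_commute[OF _ top_in_L] by metis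
qed (simp add: meet_top top_in_L)

text \<open>If neither function is the top, both are positive somewhere below \<open>1\<close>, and so is their join, at
  the larger of the two points.\<close>

lemma join_eq_top_iff:
  assumes "f \<in> L" "g \<in> L"
  shows "join f g = char_fun {1} \<longleftrightarrow> f = char_fun {1} \<or> g = char_fun {1}"
proof
  assume top: "join f g = char_fun {1}"
  show "f = char_fun {1} \<or> g = char_fun {1}"
  proof (rule ccontr)
    assume "\<not> (f = char_fun {1} \<or> g = char_fun {1})"
    then obtain x y where xy: "x \<in> level f 0" "x < 1" "y \<in> level g 0" "y < 1"
      using non_top_reaches_below_one assms by metis
    then have "max x y \<in> level (join f g) 0"
      using assms by (auto simp: level_join_L intro: smaxI)
    then show False using xy by (auto simp: top level_top max_def split: if_splits)
  qed
qed (use assms join_top join_commute[OF _ top_in_L] in auto)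

section \<open>Trimming the value at one\<close>

definition trim :: "(real \<Rightarrow> real) \<Rightarrow> real \<Rightarrow> real" where
  "trim k = (if k 1 = 1 then k else (\<lambda>x\<in>I. if x = 1 then 0 else k x))"

lemma level_trim:
  "0 \<le> t \<Longrightarrow> level (trim k) t = (if k 1 = 1 then level k t else level k t - {1})"
  by (auto simp: trim_def level_def)

lemma trim_id: "k 1 = 1 \<Longrightarrow> trim k = k"
  by (simp add: trim_def)

lemma trim_in_L:
  assumes k: "k \<in> L"
  shows "trim k \<in> L"
proof (cases "k 1 = 1")
  case True
  then show ?thesis using k by (simp add: trim_id)
next
  case False
  have "trim k \<in> M"
    unfolding trim_def if_not_P[OF False]
    by (rule M_I) (use M_value[OF L_subset_M[OF k]] in simp)
  moreover have "is_interval (level k t - {1})" if t: "0 \<le> t" "t < 1" for t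
    unfolding is_interval_1
  proof (intro ballI allI impI)
    fix a b x assume ab: "a \<in> level k t - {1}" "b \<in> level k t - {1}" and x: "a \<le> x \<and> x \<le> b"
    then have "x \<in> level k t" using L_level(2)[OF k t] is_interval_between by blast
    moreover have "b < 1" using ab by (auto simp: level_def)
    ultimately show "x \<in> level k t - {1}" using x by auto
  qed
  moreover have "level (trim k) t = level k t - {1}" if "0 \<le> t" for t
    using that False by (simp add: level_trim)
  ultimately show ?thesis
    unfolding L_iff_level using level_reaches_below_one[OF k False] by metis
qed

lemma meet_at_one: "meet f g 1 = min (f 1) (g 1)"
proof -
  have "{min (f y) (g z) | y z. y \<in> I \<and> z \<in> I \<and> min y z = 1} = {min (f 1) (g 1)}"
  proof -
    have "y \<in> I \<and> z \<in> I \<and> min y z = 1 \<longleftrightarrow> y = 1 \<and> z = 1" for y z :: real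
      by (auto simp: min_def)
    then show ?thesis by simp
  qed
  then show ?thesis by (simp add: meet_def)
qed

text \<open>Normality makes all level sets of the other function nonempty, so that \<open>1\<close> belongs to a level set
  of the join as soon as it belongs to one of the two level sets.\<close>

lemma join_at_one_eq_1_iff:
  assumes f: "f \<in> L" and g: "g \<in> L"
  shows "join f g 1 = 1 \<longleftrightarrow> f 1 = 1 \<or> g 1 = 1"
proof -
  have *: "t < join f g 1 \<longleftrightarrow> t < f 1 \<or> t < g 1" if t: "0 \<le> t" "t < 1" for t
  proof -
    have "1 \<in> smax (level f t) (level g t) \<longleftrightarrow> 1 \<in> level f t \<or> 1 \<in> level g t"
    proof
      assume "1 \<in> smax (level f t) (level g t)"
      then show "1 \<in> level f t \<or> 1 \<in> level g t"
        by (auto elim!: smaxE simp: max_def split: if_splits)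
    next
      assume or: "1 \<in> level f t \<or> 1 \<in> level g t"
      obtain x y where xy: "x \<in> level f t" "y \<in> level g t" using L_level(1) f g t by blast
      then have "x \<le> 1" "y \<le> 1" by (auto simp: level_def)
      then have "1 = max 1 y" "1 = max x 1" by auto
      then show "1 \<in> smax (level f t) (level g t)" using or xy smaxI by metis
    qed
    then show ?thesis using f g by (simp add: one_in_level flip: level_join_L)
  qed
  have bd: "0 \<le> k 1" "k 1 \<le> 1" if "k \<in> L" for k
    using M_value[OF L_subset_M[OF that], of 1] by auto
  show ?thesis
  proof
    assume one: "join f g 1 = 1"
    show "f 1 = 1 \<or> g 1 = 1"
    proof (rule ccontr)
      assume "\<not> (f 1 = 1 \<or> g 1 = 1)"
      then have "0 \<le> max (f 1) (g 1)" "max (f 1) (g 1) < 1"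
        using bd[OF f] bd[OF g] by auto
      then show False using *[of "max (f 1) (g 1)"] one by auto
    qed
  next
    assume or: "f 1 = 1 \<or> g 1 = 1"
    show "join f g 1 = 1"
    proof (rule ccontr)
      assume "join f g 1 \<noteq> 1"
      then have "0 \<le> join f g 1" "join f g 1 < 1"
        using bd[OF join_in_L[OF f g]] by auto
      then show False using *[of "join f g 1"] or by auto
    qed
  qed
qed

lemma trim_idem: "trim (trim k) = trim k"
  by (auto simp: trim_def)

lemma trim_eq_self: "k \<in> L \<Longrightarrow> k 1 \<in> {0, 1} \<Longrightarrow> trim k = k"
  by (rule L_eqI_level) (auto simp: trim_in_L level_trim one_in_level)

text \<open>On level sets, minima are taken before removing \<open>1\<close> on one side and after it on the other. The
  two agree because a function with \<open>k 1 \<noteq> 1\<close> has level sets that reach below \<open>1\<close>, so that the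
  removed element can be replaced by a smaller one.\<close>

lemma trim_meet:
  assumes f: "f \<in> L" and g: "g \<in> L"
  shows "trim (meet f g) = meet (trim f) (trim g)"
proof (rule L_eqI_level)
  show "trim (meet f g) \<in> L" "meet (trim f) (trim g) \<in> L"
    using assms by (auto intro: trim_in_L meet_in_L)
  fix t :: real assume t: "0 \<le> t" "t < 1"
  let ?A = "level f t" and ?B = "level g t"
  have right: "smin A (?B - {1}) = smin A ?B - {1}" if "g 1 \<noteq> 1" for A
    by (rule smin_remove_greatest[OF L_level(2)[OF g t] level_le_1
          level_reaches_below_one[OF g that t]])
  have left: "smin (?A - {1}) B = smin ?A B - {1}" if "f 1 \<noteq> 1" for B
    unfolding smin_commute[of _ B]
    by (rule smin_remove_greatest[OF L_level(2)[OF f t] level_le_1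
          level_reaches_below_one[OF f that t]])
  have one: "meet f g 1 = 1 \<longleftrightarrow> f 1 = 1 \<and> g 1 = 1"
    using M_value[OF L_subset_M[OF f], of 1] M_value[OF L_subset_M[OF g], of 1]
    by (auto simp: meet_at_one min_def)
  show "level (trim (meet f g)) t = level (meet (trim f) (trim g)) t"
    using f g t by (simp add: level_trim level_meet_L trim_in_L one left right)
qed

lemma trim_join:
  assumes f: "f \<in> L" and g: "g \<in> L"
  shows "trim (join f g) = join (trim f) (trim g)"
proof (rule L_eqI_level)
  show "trim (join f g) \<in> L" "join (trim f) (trim g) \<in> L"
    using assms by (auto intro: trim_in_L join_in_L)
  fix t :: real assume t: "0 \<le> t" "t < 1"
  let ?A = "level f t" and ?B = "level g t"
  have right: "smax ?A (?B - {1}) = smax ?A ?B" if "f 1 = 1" "g 1 \<noteq> 1"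
    using that t by (intro smax_remove_greatest_right level_le_1 level_reaches_below_one g)
      (simp_all add: one_in_level)
  have left: "smax (?A - {1}) ?B = smax ?A ?B" if "f 1 \<noteq> 1" "g 1 = 1"
    unfolding smax_commute[of _ ?B]
    using that t by (intro smax_remove_greatest_right level_le_1 level_reaches_below_one f)
      (simp_all add: one_in_level)
  have both: "smax (?A - {1}) (?B - {1}) = smax ?A ?B - {1}"
    by (intro smax_remove_greatest level_le_1)
  show "level (trim (join f g)) t = level (join (trim f) (trim g)) t"
    using f g t left right both
    by (simp add: level_trim level_join_L trim_in_L join_at_one_eq_1_iff)
qed

lemma meet_trim:
  assumes k: "k \<in> L"
  shows "meet k (trim k) = trim k"
proof (rule L_eqI_level)
  show "meet k (trim k) \<in> L" "trim k \<in> L" using k by (auto intro: trim_in_L meet_in_L)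
  fix t :: real assume t: "0 \<le> t" "t < 1"
  have "smin (level k t) (level k t - {1}) = level k t - {1}" if "k 1 \<noteq> 1"
    using smin_remove_greatest[OF L_level(2)[OF k t] level_le_1
        level_reaches_below_one[OF k that t]] by (simp add: smin_idem)
  then show "level (meet k (trim k)) t = level (trim k) t"
    using k t by (simp add: level_meet_L trim_in_L level_trim smin_idem)
qed

lemma trim_eq_top_iff:
  assumes k: "k \<in> L"
  shows "trim k = char_fun {1} \<longleftrightarrow> k = char_fun {1}"
proof
  assume "trim k = char_fun {1}"
  then show "k = char_fun {1}"
    using meet_trim[OF k] meet_eq_top_iff[OF k top_in_L] by simp
qed (simp add: trim_id char_fun_def)

section \<open>The operation \<open>star\<close>\<close>

lemma star_top_left: "star (char_fun {1}) g = g"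
  by (simp add: star_def)

lemma star_top_right: "star f (char_fun {1}) = f"
  by (simp add: star_def)

lemma star_eq_trim_meet:
  "f \<noteq> char_fun {1} \<Longrightarrow> g \<noteq> char_fun {1} \<Longrightarrow> star f g = trim (meet f g)"
  by (simp add: star_def trim_def meet_at_one barwedge_def)

lemma star_in_L: "f \<in> L \<Longrightarrow> g \<in> L \<Longrightarrow> star f g \<in> L"
  by (cases "f = char_fun {1}"; cases "g = char_fun {1}")
    (simp_all add: star_top_left star_top_right star_eq_trim_meet trim_in_L meet_in_L)

lemma star_commute: "f \<in> L \<Longrightarrow> g \<in> L \<Longrightarrow> star f g = star g f"
  by (cases "f = char_fun {1}"; cases "g = char_fun {1}")
    (simp_all add: star_top_left star_top_right star_eq_trim_meet meet_commute)

lemma star_assoc: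
  assumes L: "f \<in> L" "g \<in> L" "h \<in> L"
  shows "star (star f g) h = star f (star g h)"
proof (cases "f = char_fun {1} \<or> g = char_fun {1} \<or> h = char_fun {1}")
  case True
  then show ?thesis by (auto simp: star_top_left star_top_right)
next
  case False
  then have "star (star f g) h = trim (meet (trim (meet f g)) h)"
    "star f (star g h) = trim (meet f (trim (meet g h)))"
    using L by (simp_all add: star_eq_trim_meet trim_eq_top_iff meet_in_L meet_eq_top_iff)
  then show ?thesis using L by (simp add: trim_meet trim_idem trim_in_L meet_in_L meet_assoc)
qed

text \<open>In the order of \<open>L\<close>, \<open>star f g\<close> lies below \<open>f\<close>, because \<open>trim\<close> only lowers \<open>meet f g\<close>. This
  and its dual \<open>join_star\<close> settle the distributive laws when an argument is the top.\<close>

lemma meet_star: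
  assumes L: "f \<in> L" "g \<in> L"
  shows "meet f (star f g) = star f g"
proof (cases "f = char_fun {1} \<or> g = char_fun {1}")
  case True
  then show ?thesis using L by (auto simp: star_top_left star_top_right meet_top meet_idem)
next
  case False
  let ?m = "meet f g"
  have m: "?m \<in> L" "trim ?m \<in> L" using L by (auto intro: meet_in_L trim_in_L)
  have "meet f (trim ?m) = meet f (meet ?m (trim ?m))" using m by (simp add: meet_trim)
  also have "\<dots> = meet (meet (meet f f) g) (trim ?m)" using L m by (simp add: meet_assoc meet_in_L)
  also have "\<dots> = trim ?m" using L m by (simp add: meet_idem meet_trim)
  finally show ?thesis using False by (simp add: star_eq_trim_meet)
qed

lemma join_star: "f \<in> L \<Longrightarrow> g \<in> L \<Longrightarrow> join f (star f g) = f"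
  using join_meet_absorb[of f "star f g"] by (simp add: meet_star star_in_L)

text \<open>Off the top this is the distributive law of \<open>L\<close> under the homomorphism \<open>trim\<close>. A join is the top
  only if one of its arguments is, and then the law is absorption, since \<open>star f h\<close> lies below
  \<open>f\<close>.\<close>

lemma star_join_distrib:
  assumes L: "f \<in> L" "g \<in> L" "h \<in> L"
  shows "star f (join g h) = join (star f g) (star f h)"
proof -
  consider "f = char_fun {1}" | "g = char_fun {1}" | "h = char_fun {1}"
    | "f \<noteq> char_fun {1}" "g \<noteq> char_fun {1}" "h \<noteq> char_fun {1}"
    by blast
  then show ?thesis
  proof cases
    case 1
    then show ?thesis by (simp add: star_top_left)
  next
    case 2
    then show ?thesis using L by (simp add: join_top star_top_right join_star)
  next
    case 3
    then have "join g h = char_fun {1}" using L by (simp add: join_eq_top_iff)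
    moreover have "join (star f g) f = f"
      using L join_commute[OF star_in_L, of f g f] by (simp add: join_star)
    ultimately show ?thesis using 3 by (simp add: star_top_right)
  next
    case 4
    then have "star f (join g h) = trim (meet f (join g h))"
      using L by (simp add: star_eq_trim_meet join_eq_top_iff)
    also have "\<dots> = join (trim (meet f g)) (trim (meet f h))"
      using L by (simp only: meet_join_distrib trim_join meet_in_L)
    finally show ?thesis using 4 by (simp add: star_eq_trim_meet)
  qed
qed

lemma star_meet_distrib:
  assumes L: "f \<in> L" "g \<in> L" "h \<in> L"
  shows "star f (meet g h) = meet (star f g) (star f h)"
proof -
  consider "f = char_fun {1}" | "g = char_fun {1}" | "h = char_fun {1}"
    | "f \<noteq> char_fun {1}" "g \<noteq> char_fun {1}" "h \<noteq> char_fun {1}"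
    by blast
  then show ?thesis
  proof cases
    case 1
    then show ?thesis by (simp add: star_top_left)
  next
    case 2
    then show ?thesis using L by (simp add: meet_top star_top_right meet_star)
  next
    case 3
    then have "meet g h = g" using L meet_commute[OF L(2) top_in_L] by (simp add: meet_top)
    moreover have "meet (star f g) f = star f g"
      using L meet_commute[OF star_in_L, of f g f] by (simp add: meet_star)
    ultimately show ?thesis using 3 by (simp add: star_top_right)
  next
    case 4
    then have "star f (meet g h) = trim (meet f (meet g h))"
      using L by (simp add: star_eq_trim_meet meet_eq_top_iff)
    also have "\<dots> = meet (trim (meet f g)) (trim (meet f h))"
      unfolding meet_distrib_meet[OF L] by (rule trim_meet) (intro meet_in_L L)+
    finally show ?thesis using 4 by (simp add: star_eq_trim_meet)
  qed
qed

text \<open>The relation \<open>f \<sqsubseteq> g\<close> is the equation \<open>meet f g = f\<close>, which any operation distributing over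
  \<open>meet\<close> preserves.\<close>

lemma star_mono:
  assumes L: "f \<in> L" "g \<in> L" "h \<in> L" and le: "le_meet f g"
  shows "le_meet (star f h) (star g h)"
proof -
  have "meet (star h f) (star h g) = star h f"
    using star_meet_distrib[OF L(3,1,2)] le by (simp add: le_meet_def)
  then show ?thesis
    unfolding le_meet_def star_commute[OF L(1,3)] star_commute[OF L(2,3)] .
qed

text \<open>A characteristic function takes only the values \<open>0\<close> and \<open>1\<close>, so \<open>trim\<close> leaves it unchanged.\<close>

lemma star_char_fun:
  assumes "0 \<le> a" "a \<le> b" "b \<le> 1" "0 \<le> c" "c \<le> d" "d \<le> 1"
  shows "star (char_fun {a..b}) (char_fun {c..d}) = char_fun {min a c..min b d}"
proof -
  let ?f = "char_fun {a..b}" and ?g = "char_fun {c..d}"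
  have L: "?f \<in> L" "?g \<in> L" using assms by (auto intro: char_fun_in_L)
  have m: "meet ?f ?g = char_fun {min a c..min b d}" using assms by (rule meet_char_fun)
  moreover have "meet ?f ?g 1 \<in> {0, 1}"
    unfolding m by (simp add: char_fun_def indicator_def)
  then have "trim (meet ?f ?g) = meet ?f ?g" using L by (intro trim_eq_self meet_in_L)
  moreover have "meet ?f ?g = star ?f ?g" if "?f = char_fun {1} \<or> ?g = char_fun {1}"
    using that
  proof
    assume "?f = char_fun {1}"
    then show ?thesis using L meet_top[of ?g] by (simp add: star_top_left)
  next
    assume "?g = char_fun {1}"
    then show ?thesis
      using L meet_top[of ?f] meet_commute[of ?f ?g] by (simp add: star_top_right)
  qed
  ultimately show ?thesis using star_eq_trim_meet[of ?f ?g] by metis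
qed

lemma star_closed_on_J: "closed_on J star"
  unfolding closed_on_def
proof (intro ballI)
  fix f g assume "f \<in> J" "g \<in> J"
  then obtain x y where xy: "x \<in> I" "y \<in> I" "f = char_fun {x}" "g = char_fun {y}"
    by (auto simp: J_def)
  have "star f g = char_fun {min x y}"
    using star_char_fun[of x x y y] xy by simp
  moreover have "min x y \<in> I" using xy by auto
  ultimately show "star f g \<in> J" unfolding J_def by blast
qed

lemma star_closed_on_K: "closed_on K star"
  unfolding closed_on_def
proof (intro ballI)
  fix f g assume "f \<in> K" "g \<in> K"
  then obtain a b c d where ab: "0 \<le> a" "a \<le> b" "b \<le> 1" "f = char_fun {a..b}"
    and cd: "0 \<le> c" "c \<le> d" "d \<le> 1" "g = char_fun {c..d}"
    by (auto simp: K_def)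
  then have "star f g = char_fun {min a c..min b d}" by (simp add: star_char_fun)
  moreover have "0 \<le> min a c" "min a c \<le> min b d" "min b d \<le> 1" using ab cd by auto
  ultimately show "star f g \<in> K" unfolding K_def by blast
qed

theorem theorem2:
  shows "tlor_norm star \<and> tr_norm star"
proof -
  have unit_interval: "star (char_fun {0..1}) (char_fun {a..b}) = char_fun {0..b}"
    if "0 \<le> a" "a \<le> b" "b \<le> 1" for a b :: real
    using star_char_fun[of 0 1 a b] that by simp
  have closed: "closed_on L star" by (simp add: closed_on_def star_in_L)
  show ?thesis
    unfolding tlor_norm_def tr_norm_def
    by (intro conjI ballI allI impI; (elim conjE)?;
        (rule star_commute star_assoc star_top_right star_join_distrib star_meet_distrib
          star_mono unit_interval closed star_closed_on_J star_closed_on_K; assumption))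
qed

end
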